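(* Let $S\subset\mathbb{R}^n$ be nonempty and closed, let $I=\{1,\ldots,m\}$, $J=\{1,\ldots,p\}$, let $f_i^L,f_i^U,g_i^L,g_i^U\colon\mathbb{R}^n\to\mathbb{R}$ ($i\in I$) and $h_j\colon\mathbb{R}^n\to\mathbb{R}$ ($j\in J$) be locally Lipschitzian functions with $0\le f_i^L(x)\le f_i^U(x)$ and $0<g_i^L(x)\le g_i^U(x)$ for all $x\in S$, $i\in I$, and let $\Omega=\{x\in S: h_j(x)\le 0,\ j\in J\}$. If $\bar x\in\Omega$ is a type-2 weakly Pareto solution of the fractional interval-valued multiobjective problem (FIMP), then there exist $\lambda_i^L\geq 0$, $\lambda_i^U\geq 0$, $i\in I$, and $\mu_j\geq 0$, $j\in J$, with $\sum_{i\in I}(\lambda_i^L+\lambda_i^U)+\sum_{j\in J}\mu_j=1$, such that $$0\in \sum_{i\in I}\frac{\lambda_i^L}{g_i^U(\bar x)} \left[\partial f_i^L(\bar x)-\frac{f_i^L(\bar x)}{g_i^U(\bar x)}\partial^+ g_i^U(\bar x)\right]+\sum_{i\in I}\frac{\lambda_i^U}{g_i^L(\bar x)} \left[\partial f_i^U(\bar x)-\frac{f_i^U(\bar x)}{g_i^L(\bar x)}\partial^+ g_i^L(\bar x)\right]+\sum_{j\in J}\mu_j\partial h_j(\bar x)+N(\bar x; S)$$ and $\mu_j h_j(\bar x)=0$ for all $j\in J$.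
   Context: Variational analysis. For $S\subset\mathbb{R}^n$, $x\in S$ and $\varepsilon\ge 0$, $\widehat N_\varepsilon(x;S):=\{z^*\in\mathbb{R}^n:\limsup_{u\to x,\,u\in S}\frac{\langle z^*,u-x\rangle}{\|u-x\|}\le\varepsilon\}$. The limiting (Mordukhovich) normal cone $N(\bar x;S)$ of $S$ at $\bar x\in\mathrm{cl}\,S$ is the set of all $z^*\in\mathbb{R}^n$ for which there exist $x^k\to\bar x$ with $x^k\in S$, $\varepsilon_k\to0^+$ and $z_k^*\to z^*$ with $z_k^*\in\widehat N_{\varepsilon_k}(x^k;S)$ for all $k$. For $\varphi\colon\mathbb{R}^n\to\overline{\mathbb{R}}$ finite at $\bar x$, the limiting (Mordukhovich) subdifferential is $\partial\varphi(\bar x):=\{x^*\in\mathbb{R}^n:(x^*,-1)\in N((\bar x,\varphi(\bar x));\mathrm{epi}\,\varphi)\}$, where $\mathrm{epi}\,\varphi=\{(x,\alpha)\in\mathbb{R}^n\times\mathbb{R}:\varphi(x)\le\alpha\}$. The upper subdifferential is $\partial^+\varphi(\bar x):=-\partial(-\varphi)(\bar x)$. Sums and scalar multiples of sets are taken elementwise (Minkowski). Problem. $f_i=[f_i^L,f_i^U]$ and $g_i=[g_i^L,g_i^U]$ are interval-valued functions, and for $i\in I$ and $x\in S$ $$F_i(x):=\frac{f_i(x)}{g_i(x)}=\left[\frac{f_i^L(x)}{g_i^U(x)},\frac{f_i^U(x)}{g_i^L(x)}\right].$$ (FIMP) is the problem of minimizing $F=(F_1,\ldots,F_m)$ over $\Omega$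 with respect to the lower-upper (LU) interval order. For closed bounded intervals $A=[a^L,a^U]$, $B=[b^L,b^U]$, write $A<^s_{LU}B$ if $a^L<b^L$ and $a^U<b^U$. A point $\bar x\in\Omega$ is a type-2 weakly Pareto solution of (FIMP) if there is no $x\in\Omega$ such that $F_i(x)<^s_{LU}F_i(\bar x)$ for all $i\in I$. *)

theory Defs
  imports "HOL-Analysis.Analysis" "HOL-Library.Interval"
begin

definition locally_lipschitzian :: "('a::metric_space \<Rightarrow> 'b::metric_space) \<Rightarrow> bool" where
  "locally_lipschitzian f \<longleftrightarrow> (\<forall>x. \<exists>r>0. \<exists>L. L-lipschitz_on (ball x r) f)"

(* The filter "at x within S" excludes x itself.  If x is isolated in S it is trivial, the upper
   limit is -\<infinity>, and every vector is normal. *)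
definition eps_normals :: "real \<Rightarrow> 'a::real_inner \<Rightarrow> 'a set \<Rightarrow> 'a set" where
  "eps_normals \<epsilon> x S =
     {z. Limsup (at x within S) (\<lambda>u. ereal (inner z (u - x) / norm (u - x))) \<le> ereal \<epsilon>}"

definition limiting_normal_cone :: "'a::real_inner \<Rightarrow> 'a set \<Rightarrow> 'a set" where
  "limiting_normal_cone xbar S =
     {z. \<exists>(x :: nat \<Rightarrow> 'a) (\<epsilon> :: nat \<Rightarrow> real) (y :: nat \<Rightarrow> 'a).
           (\<forall>k. x k \<in> S) \<and> x \<longlonglongrightarrow> xbar \<and> (\<forall>k. \<epsilon> k > 0) \<and> \<epsilon> \<longlonglongrightarrow> 0 \<and> y \<longlonglongrightarrow> z \<and>
           (\<forall>k. y k \<in> eps_normals (\<epsilon> k) (x k) S)}"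

definition epi :: "('a \<Rightarrow> ereal) \<Rightarrow> ('a \<times> real) set" where
  "epi \<phi> = {(x, \<alpha>). \<phi> x \<le> ereal \<alpha>}"

(* The notion is only meaningful where \<phi> is finite; it is empty elsewhere. *)
definition limiting_subdiff :: "('a::real_inner \<Rightarrow> ereal) \<Rightarrow> 'a \<Rightarrow> 'a set" where
  "limiting_subdiff \<phi> xbar =
     {v. \<bar>\<phi> xbar\<bar> \<noteq> \<infinity> \<and>
         (v, - 1) \<in> limiting_normal_cone (xbar, real_of_ereal (\<phi> xbar)) (epi \<phi>)}"

definition upper_subdiff :: "('a::real_inner \<Rightarrow> ereal) \<Rightarrow> 'a \<Rightarrow> 'a set" where
  "upper_subdiff \<phi> xbar = uminus ` limiting_subdiff (\<lambda>x. - \<phi> x) xbar"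

definition set_scale :: "real \<Rightarrow> 'a::real_vector set \<Rightarrow> 'a set" (infixr "\<odot>" 75) where
  "c \<odot> A = (\<lambda>a. c *\<^sub>R a) ` A"

(* The difference A - B = {a - b} of Minkowski; "-" on sets is the set-theoretic difference.
   Addition and finite sums of sets are elementwise already (HOL-Library.Set_Algebras). *)
definition set_diff_elementwise :: "'a::group_add set \<Rightarrow> 'a set \<Rightarrow> 'a set" (infixl "\<ominus>" 65) where
  "A \<ominus> B = {a - b | a b. a \<in> A \<and> b \<in> B}"

(* The quotient [a, b] / [c, d] = [a / d, b / c], for 0 \<le> a and 0 < c. *)
definition interval_quotient :: "real interval \<Rightarrow> real interval \<Rightarrow> real interval" where
  "interval_quotient A B = Interval (lower A / upper B, upper A / lower B)"

definition LU_sless :: "real interval \<Rightarrow> real interval \<Rightarrow> bool" where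
  "LU_sless A B \<longleftrightarrow> lower A < lower B \<and> upper A < upper B"

(* Only the values of F on \<Omega> matter. *)
definition type2_weakly_pareto ::
    "'i set \<Rightarrow> ('i \<Rightarrow> 'a \<Rightarrow> real interval) \<Rightarrow> 'a set \<Rightarrow> 'a \<Rightarrow> bool" where
  "type2_weakly_pareto I F \<Omega> xbar \<longleftrightarrow>
     xbar \<in> \<Omega> \<and> \<not> (\<exists>x\<in>\<Omega>. \<forall>i\<in>I. LU_sless (F i x) (F i xbar))"

end

theory Submission
  imports Defs
begin

text \<open>
  Replacing each quotient by its numerator minus the optimal ratio times its denominator does not
  change the sign of its difference from the optimal ratio. So a weakly Pareto point minimizes over
  \<open>S\<close>, with value 0, the maximum of the functions
  \<open>(f\<^sub>i - q\<^sub>i g\<^sub>i) / g\<^sub>i(xbar)\<close> (for both end points) and \<open>h\<^sub>j\<close>; no quotient rule is needed.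
  The multipliers for such a maximum come from one penalization: every summand \<open>u\<^sub>l\<close> gets its own
  copy \<open>x\<^sub>l\<close> of the variable, the constraint gets a copy \<open>s\<close> in \<open>S\<close>, the maximum is smoothed by
  log-sum-exp with parameter \<open>n\<close>, and the penalty \<open>n * (\<Sum>l. norm (x\<^sub>l - s)\<^sup>2)\<close> ties the copies
  together. At a minimizer on a compact ball, minimality in each single variable yields an exact
  Frechet normal to the epigraph of \<open>u\<^sub>l\<close> or to \<open>S\<close>. Its gradients are bounded uniformly in \<open>n\<close>,
  and the softmax weights lie in a simplex, so a subsequence converges to the limiting normals.
\<close>

subsection \<open>Frechet normals and limiting normals\<close>

text \<open>This is \<open>eps_normals 0 x S\<close> with the upper limit unfolded and the division
  cleared, so that every later estimate is a plain inequality near \<open>x\<close>.\<close>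

definition frechet_normals :: "'a::real_inner \<Rightarrow> 'a set \<Rightarrow> 'a set" where
  "frechet_normals x S =
     {z. \<forall>\<eta>>0. \<forall>\<^sub>F u in at x within S. inner z (u - x) \<le> \<eta> * norm (u - x)}"

lemma frechet_normalsD:
  "z \<in> frechet_normals x S \<Longrightarrow> \<eta> > 0 \<Longrightarrow> \<forall>\<^sub>F u in at x within S. inner z (u - x) \<le> \<eta> * norm (u - x)"
  by (simp add: frechet_normals_def)

lemma frechet_normals_subset_eps_normals:
  assumes "\<epsilon> > 0"
  shows "frechet_normals x S \<subseteq> eps_normals \<epsilon> x S"
proof
  fix z assume "z \<in> frechet_normals x S"
  then have "\<forall>\<^sub>F u in at x within S. inner z (u - x) \<le> \<epsilon> * norm (u - x)"
    using assms by (simp add: frechet_normals_def)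
  then have "\<forall>\<^sub>F u in at x within S. ereal (inner z (u - x) / norm (u - x)) \<le> ereal \<epsilon>"
    by eventually_elim (use assms in \<open>auto simp: divide_le_eq\<close>)
  then show "z \<in> eps_normals \<epsilon> x S"
    unfolding eps_normals_def by (simp add: Limsup_bounded)
qed

lemma frechet_normals_scale:
  assumes "z \<in> frechet_normals x S" and "c > 0"
  shows "c *\<^sub>R z \<in> frechet_normals x S"
  unfolding frechet_normals_def
proof (intro CollectI allI impI)
  fix \<eta> :: real assume "\<eta> > 0"
  then have "\<forall>\<^sub>F u in at x within S. inner z (u - x) \<le> (\<eta> / c) * norm (u - x)"
    using assms by (intro frechet_normalsD) auto
  then show "\<forall>\<^sub>F u in at x within S. inner (c *\<^sub>R z) (u - x) \<le> \<eta> * norm (u - x)"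
    by eventually_elim (use \<open>c > 0\<close> in \<open>simp add: field_simps\<close>)
qed

text \<open>Fermat rule: up to an error of order o(norm (u - x)), \<open>inner z (u - x)\<close>
  equals \<open>\<phi> x - \<phi> u\<close>, which is at most 0 near a local minimizer. So minus the
  gradient is an exact Frechet normal.\<close>

lemma frechet_normals_local_min:
  assumes deriv: "(\<phi> has_derivative (\<lambda>v. - inner z v)) (at x within S)"
    and min: "\<forall>\<^sub>F u in at x within S. \<phi> x \<le> \<phi> u"
  shows "z \<in> frechet_normals x S"
  unfolding frechet_normals_def
proof (intro CollectI allI impI)
  fix \<eta> :: real assume "\<eta> > 0"
  have "((\<lambda>u. (1 / norm (u - x)) *\<^sub>R (\<phi> u - (\<phi> x + - inner z (u - x)))) \<longlongrightarrow> 0) (at x within S)"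
    using deriv by (simp add: has_derivative_within)
  then have "\<forall>\<^sub>F u in at x within S. norm ((1 / norm (u - x)) *\<^sub>R (\<phi> u - (\<phi> x + - inner z (u - x)))) < \<eta>"
    using \<open>\<eta> > 0\<close> by (simp add: tendsto_iff dist_norm)
  moreover have "\<forall>\<^sub>F u in at x within S. u \<noteq> x"
    by (simp add: eventually_at_filter)
  ultimately show "\<forall>\<^sub>F u in at x within S. inner z (u - x) \<le> \<eta> * norm (u - x)"
    using min
  proof eventually_elim
    case (elim u)
    then have "\<bar>\<phi> u - (\<phi> x + - inner z (u - x))\<bar> < \<eta> * norm (u - x)"
      by (simp add: field_simps)
    with elim show ?case by linarith
  qed
qed

text \<open>Exact normals are \<open>\<epsilon>\<close>-normals for every positive tolerance, so the
  tolerances 1 / (k + 1) can be prescribed freely. A shift by \<open>N\<close> drops the finitely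
  many bad indices.\<close>

lemma limiting_normal_coneI:
  assumes "x \<longlonglongrightarrow> xbar" "y \<longlonglongrightarrow> z"
    and ev: "\<forall>\<^sub>F k in sequentially. x k \<in> S \<and> y k \<in> frechet_normals (x k) S"
  shows "z \<in> limiting_normal_cone xbar S"
proof -
  obtain N where "\<And>k. k \<ge> N \<Longrightarrow> x k \<in> S \<and> y k \<in> frechet_normals (x k) S"
    using ev unfolding eventually_sequentially by blast
  then have N: "x (k + N) \<in> S \<and> y (k + N) \<in> frechet_normals (x (k + N)) S" for k
    by simp
  show ?thesis
    unfolding limiting_normal_cone_def
  proof (intro CollectI exI conjI allI)
    show "(\<lambda>k. inverse (real (Suc k))) \<longlonglongrightarrow> 0"
      by (rule LIMSEQ_inverse_real_of_nat)
    show "(\<lambda>k. x (k + N)) \<longlonglongrightarrow> xbar" "(\<lambda>k. y (k + N)) \<longlonglongrightarrow> z"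
      using assms(1,2) by (auto intro: LIMSEQ_ignore_initial_segment)
    show "y (k + N) \<in> eps_normals (inverse (real (Suc k))) (x (k + N)) S" for k
      using N[of k] frechet_normals_subset_eps_normals[of "inverse (real (Suc k))"] by auto
  qed (use N in auto)
qed

lemma epi_real: "epi (ereal \<circ> u) = {(x, \<alpha>). u x \<le> \<alpha>}"
  by (simp add: epi_def)

lemma limiting_subdiff_real:
  "v \<in> limiting_subdiff (ereal \<circ> u) x \<longleftrightarrow> (v, -1) \<in> limiting_normal_cone (x, u x) (epi (ereal \<circ> u))"
  by (simp add: limiting_subdiff_def)

text \<open>The Lipschitz bound keeps the direction \<open>(z, L * norm z)\<close> inside the
  epigraph; testing the normal against it gives \<open>norm z * (norm z - L * w) \<le> 0\<close> to
  first order. The bound controls gradients by their weights and forces \<open>z = 0\<close> when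
  \<open>w = 0\<close>.\<close>

lemma frechet_normal_epi_bound:
  fixes u :: "'a::real_inner \<Rightarrow> real"
  assumes lip: "L-lipschitz_on (cball x r) u" and "r > 0"
    and normal: "(z, - w) \<in> frechet_normals (x, u x) (epi (ereal \<circ> u))"
  shows "norm z \<le> L * w"
proof (cases "z = 0")
  case True
  \<comment> \<open>For \<open>z = 0\<close> the test direction above degenerates. The vertical
    direction, which always stays in the epigraph, excludes \<open>w < 0\<close> instead.\<close>
  have "L * w \<ge> 0"
  proof (rule ccontr)
    assume neg: "\<not> L * w \<ge> 0"
    have "L \<ge> 0" using lip by (rule lipschitz_on_nonneg)
    with neg have "w < 0" by (metis linorder_not_le mult_nonneg_nonneg)
    let ?F = "at (x, u x) within epi (ereal \<circ> u)"
    have "\<forall>\<^sub>F p in ?F. inner (z, - w) (p - (x, u x)) \<le> (- w / 2) * norm (p - (x, u x))"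
      using \<open>w < 0\<close> by (intro frechet_normalsD[OF normal]) simp
    then obtain d where "d > 0" and d: "\<And>p. p \<in> epi (ereal \<circ> u) \<Longrightarrow> p \<noteq> (x, u x) \<Longrightarrow> dist p (x, u x) < d \<Longrightarrow>
        inner (z, - w) (p - (x, u x)) \<le> (- w / 2) * norm (p - (x, u x))"
      unfolding eventually_at by auto
    have "inner (z, - w) ((x, u x + d/2) - (x, u x)) \<le> (- w / 2) * norm ((x, u x + d/2) - (x, u x))"
      using \<open>d > 0\<close> by (intro d) (auto simp: epi_real dist_norm norm_Pair)
    then have "- w * (d / 2) \<le> - w / 2 * (d / 2)"
      using \<open>d > 0\<close> by (simp add: norm_Pair)
    moreover have "- w * d > 0" using \<open>w < 0\<close> \<open>d > 0\<close> by (simp add: mult_neg_pos)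
    ultimately show False by (simp add: field_simps)
  qed
  with True show ?thesis by simp
next
  case False
  have "L \<ge> 0" using lip by (rule lipschitz_on_nonneg)
  have "norm z - L * w \<le> \<eta>" if "\<eta> > 0" for \<eta>
  proof -
    \<comment> \<open>The test point \<open>?p\<close> lies at distance \<open>t * norm z\<close>
      times sqrt (1 + L^2) from the base point, so this tolerance leaves the error
      \<open>t * norm z * \<eta>\<close>.\<close>
    define e where "e = \<eta> / sqrt (1 + L\<^sup>2)"
    have pos: "sqrt (1 + L\<^sup>2) > 0" by (simp add: add_pos_nonneg)
    have "e > 0" using that pos by (simp add: e_def)
    then obtain d where "d > 0" and d: "\<And>p. p \<in> epi (ereal \<circ> u) \<Longrightarrow> p \<noteq> (x, u x) \<Longrightarrow> dist p (x, u x) < d \<Longrightarrow>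
        inner (z, - w) (p - (x, u x)) \<le> e * norm (p - (x, u x))"
      using frechet_normalsD[OF normal, of e] unfolding eventually_at by blast
    \<comment> \<open>The step length \<open>t * norm z\<close> must respect the Lipschitz ball of
      radius \<open>r\<close> and, strictly, the neighbourhood of radius \<open>d\<close>; the
      factor 2 gives strictness.\<close>
    define t where "t = min r (d / (2 * sqrt (1 + L\<^sup>2))) / norm z"
    have "t > 0"
      using \<open>r > 0\<close> \<open>d > 0\<close> False pos by (simp add: t_def)
    have tz: "t * norm z \<le> r" "t * norm z * sqrt (1 + L\<^sup>2) < d"
    proof -
      have eq: "t * norm z = min r (d / (2 * sqrt (1 + L\<^sup>2)))"
        using False by (simp add: t_def)
      show "t * norm z \<le> r" by (simp add: eq)
      have "t * norm z * sqrt (1 + L\<^sup>2) \<le> d / (2 * sqrt (1 + L\<^sup>2)) * sqrt (1 + L\<^sup>2)"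
        unfolding eq using pos by (intro mult_right_mono) auto
      also have "\<dots> = d / 2" using pos by simp
      finally show "t * norm z * sqrt (1 + L\<^sup>2) < d" using \<open>d > 0\<close> by linarith
    qed
    let ?p = "(x + t *\<^sub>R z, u x + L * (t * norm z))"
    have "\<bar>u (x + t *\<^sub>R z) - u x\<bar> \<le> L * (t * norm z)"
      using lipschitz_onD[OF lip, of "x + t *\<^sub>R z" x] tz(1) \<open>t > 0\<close> \<open>r > 0\<close>
      by (simp add: dist_norm)
    then have "?p \<in> epi (ereal \<circ> u)" by (auto simp: epi_real)
    moreover have nrm: "norm (?p - (x, u x)) = t * norm z * sqrt (1 + L\<^sup>2)"
    proof -
      have "norm (?p - (x, u x)) = sqrt ((t * norm z)\<^sup>2 * (1 + L\<^sup>2))"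
        by (simp add: norm_Pair power_mult_distrib algebra_simps)
      then show ?thesis using \<open>t > 0\<close> by (simp add: real_sqrt_mult)
    qed
    ultimately have "inner (z, - w) (?p - (x, u x)) \<le> e * norm (?p - (x, u x))"
      using tz(2) False \<open>t > 0\<close> by (intro d) (auto simp: dist_norm)
    then have "t * (norm z)\<^sup>2 - w * (L * (t * norm z)) \<le> e * (t * norm z * sqrt (1 + L\<^sup>2))"
      unfolding nrm by (simp add: power2_norm_eq_inner)
    then have "(t * norm z) * (norm z - L * w) \<le> (t * norm z) * \<eta>"
      using pos by (simp add: e_def power2_eq_square algebra_simps)
    then show ?thesis
      using \<open>t > 0\<close> False by simp
  qed
  then have "norm z - L * w \<le> 0" by (meson dense_ge)
  then show ?thesis by simp
qed

subsection \<open>Locally Lipschitzian functions\<close>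

lemma locally_lipschitzian_isCont:
  assumes "locally_lipschitzian f"
  shows "isCont f x"
proof -
  obtain r L where "r > 0" "L-lipschitz_on (ball x r) f"
    using assms unfolding locally_lipschitzian_def by blast
  then show ?thesis
    using lipschitz_on_continuous_on continuous_on_eq_continuous_at[OF open_ball] centre_in_ball by blast
qed

lemma locally_lipschitzian_uminus:
  fixes f :: "'a::metric_space \<Rightarrow> 'b::real_normed_vector"
  shows "locally_lipschitzian f \<Longrightarrow> locally_lipschitzian (\<lambda>x. - f x)"
  unfolding locally_lipschitzian_def by simp

lemma locally_lipschitzian_const: "locally_lipschitzian (\<lambda>_. c)"
  unfolding locally_lipschitzian_def
  by (intro allI exI[of _ 1] conjI exI[of _ 0]) (auto simp: lipschitz_on_def)

text \<open>One closed ball for the whole finite family serves as a compact domain on which all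
  summands share the constant \<open>L\<close>.\<close>

lemma locally_lipschitzian_uniform:
  fixes u :: "'l \<Rightarrow> 'a::metric_space \<Rightarrow> 'b::metric_space"
  assumes "finite \<Lambda>" "\<And>l. l \<in> \<Lambda> \<Longrightarrow> locally_lipschitzian (u l)"
  shows "\<exists>r>0. \<exists>L. \<forall>l\<in>\<Lambda>. L-lipschitz_on (cball x r) (u l)"
  using assms
proof (induction \<Lambda> rule: finite_induct)
  case empty
  then show ?case by (intro exI[of _ 1]) auto
next
  case (insert l \<Lambda>)
  then obtain r L where 1: "r > 0" "\<forall>l\<in>\<Lambda>. L-lipschitz_on (cball x r) (u l)" by auto
  from insert.prems obtain r' L' where 2: "r' > 0" "L'-lipschitz_on (ball x r') (u l)"
    unfolding locally_lipschitzian_def by blast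
  let ?r = "min r (r' / 2)"
  have sub: "cball x ?r \<subseteq> cball x r" "cball x ?r \<subseteq> ball x r'"
    using 1 2 by auto
  have "\<forall>l'\<in>insert l \<Lambda>. (max L L')-lipschitz_on (cball x ?r) (u l')"
    using 1 2 sub by (auto intro: lipschitz_on_mono)
  moreover have "?r > 0" using 1 2 by simp
  ultimately show ?case by blast
qed

subsection \<open>Smoothing a finite maximum\<close>

text \<open>These are the partial derivatives of \<open>lse n K\<close>. Being nonnegative with sum
  1, they act as approximate multipliers.\<close>

definition softmax :: "real \<Rightarrow> 'k set \<Rightarrow> ('k \<Rightarrow> real) \<Rightarrow> 'k \<Rightarrow> real" where
  "softmax n K a k = exp (n * a k) / (\<Sum>k\<in>K. exp (n * a k))"

text \<open>Smooth approximation of the maximum of \<open>a\<close> over \<open>K\<close> from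
  above; for \<open>n > 0\<close> and finite nonempty \<open>K\<close> the error is at most
  \<open>ln (card K) / n\<close>.\<close>

definition lse :: "real \<Rightarrow> 'k set \<Rightarrow> ('k \<Rightarrow> real) \<Rightarrow> real" where
  "lse n K a = ln (\<Sum>k\<in>K. exp (n * a k)) / n"

lemma sum_exp_pos: "finite K \<Longrightarrow> K \<noteq> {} \<Longrightarrow> (\<Sum>k\<in>K. exp (n * a k :: real)) > 0"
  by (simp add: sum_pos)

lemma lse_ge:
  assumes "finite K" "k \<in> K" "n > 0"
  shows "a k \<le> lse n K a"
proof -
  have "exp (n * a k) \<le> (\<Sum>k\<in>K. exp (n * a k))"
    using assms by (intro member_le_sum) auto
  then have "n * a k \<le> ln (\<Sum>k\<in>K. exp (n * a k))"
    using assms sum_exp_pos[of K n a] by (subst ln_ge_iff) auto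
  then show ?thesis using assms by (simp add: lse_def field_simps)
qed

lemma lse_mono:
  assumes "finite K" "K \<noteq> {}" "n > 0" "\<And>k. k \<in> K \<Longrightarrow> a k \<le> b k"
  shows "lse n K a \<le> lse n K b"
proof -
  have "(\<Sum>k\<in>K. exp (n * a k)) \<le> (\<Sum>k\<in>K. exp (n * b k))"
    using assms by (intro sum_mono) auto
  then show ?thesis
    using assms sum_exp_pos[of K n a] sum_exp_pos[of K n b]
    by (auto simp: lse_def divide_right_mono)
qed

text \<open>Together with \<open>lse_mono\<close> this is the upper estimate that complements
  \<open>lse_ge\<close>.\<close>

lemma lse_const:
  assumes "finite K" "K \<noteq> {}" "n > 0"
  shows "lse n K (\<lambda>_. M) = M + ln (card K) / n"
  using assms by (simp add: lse_def ln_mult card_gt_0_iff field_simps)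

lemma softmax_nonneg: "softmax n K a k \<ge> 0"
  by (simp add: softmax_def sum_nonneg)

lemma sum_softmax: "finite K \<Longrightarrow> K \<noteq> {} \<Longrightarrow> (\<Sum>k\<in>K. softmax n K a k) = 1"
  using sum_exp_pos[of K n a] by (simp add: softmax_def flip: sum_divide_distrib)

text \<open>The derivative is taken along a line because the epigraph variable of a single summand
  \<open>l\<close> enters the \<open>k\<close>-th function affinely, with slope
  \<open>c k l\<close>.\<close>

lemma DERIV_lse:
  assumes "finite K" "K \<noteq> {}" "n > 0"
  shows "((\<lambda>t. lse n K (\<lambda>k. a k + c k * t)) has_real_derivative
      (\<Sum>k\<in>K. softmax n K (\<lambda>k. a k + c k * t) k * c k)) (at t)"
proof -
  let ?e = "\<lambda>t k. exp (n * (a k + c k * t))"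
  have "((\<lambda>t. \<Sum>k\<in>K. ?e t k) has_real_derivative (\<Sum>k\<in>K. ?e t k * (n * c k))) (at t)"
    by (intro DERIV_sum) (auto intro!: derivative_eq_intros)
  from DERIV_cdivide[OF DERIV_chain2[OF DERIV_ln[OF sum_exp_pos[OF assms(1,2)]] this], of n]
  have "((\<lambda>t. lse n K (\<lambda>k. a k + c k * t)) has_real_derivative
      inverse (\<Sum>k\<in>K. ?e t k) * (\<Sum>k\<in>K. ?e t k * (n * c k)) / n) (at t)"
    by (simp add: lse_def)
  also have "inverse (\<Sum>k\<in>K. ?e t k) * (\<Sum>k\<in>K. ?e t k * (n * c k)) / n
     = (\<Sum>k\<in>K. softmax n K (\<lambda>k. a k + c k * t) k * c k)"
    unfolding softmax_def sum_distrib_left sum_divide_distrib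
    using assms(3) by (intro sum.cong refl) (simp add: divide_inverse mult_ac)
  finally show ?thesis .
qed

lemma continuous_on_lse:
  assumes "finite K" "K \<noteq> {}" "\<And>k. k \<in> K \<Longrightarrow> continuous_on D (\<lambda>p. a p k)"
  shows "continuous_on D (\<lambda>p. lse n K (a p))"
  unfolding lse_def divide_inverse
  using assms sum_exp_pos[OF assms(1,2)]
  by (intro continuous_intros) (auto simp: less_imp_neq[symmetric] dest: less_imp_neq)

text \<open>Tychonoff's theorem for function types: the copies of the variable form one function on
  the whole index type.\<close>

lemma compact_PiE_UNIV:
  fixes C :: "'l \<Rightarrow> 'a::topological_space set"
  assumes "\<And>l. compact (C l)"
  shows "compact (PiE UNIV C)"
  using assms compactin_PiE[of "\<lambda>_. euclidean" UNIV C]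
  by (simp add: euclidean_product_topology)

subsection \<open>Multipliers for a finite maximum\<close>

text \<open>The smoothed and penalized problem for a fixed parameter \<open>n\<close>. Comparing its
  minimizer with the point whose copies all equal \<open>xbar\<close> yields the distance bounds;
  minimality in one variable at a time yields the normals. In \<open>B\<close> the first term is the
  smoothing error, the second the Lipschitz error of moving the copies to \<open>s\<close>.\<close>

lemma penalized_minimizer:
  fixes u :: "'l \<Rightarrow> 'a::euclidean_space \<Rightarrow> real" and c :: "'k \<Rightarrow> 'l \<Rightarrow> real" and n r C L M B :: real
  assumes fin: "finite \<Lambda>" "finite K" "K \<noteq> {}" and "n > 0" "r > 0"
    and lip: "\<And>l. l \<in> \<Lambda> \<Longrightarrow> L-lipschitz_on (cball xbar r) (u l)"
    and c: "\<And>k l. k \<in> K \<Longrightarrow> l \<in> \<Lambda> \<Longrightarrow> 0 \<le> c k l \<and> c k l \<le> C"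
    and S: "closed S" "xbar \<in> S"
    and le: "\<And>k. k \<in> K \<Longrightarrow> (\<Sum>l\<in>\<Lambda>. c k l * u l xbar) \<le> M"
    and ge: "\<And>x. x \<in> S \<inter> cball xbar r \<Longrightarrow> \<exists>k\<in>K. M \<le> (\<Sum>l\<in>\<Lambda>. c k l * u l x)"
    and B: "B = ln (card K) + card \<Lambda> * (C * L)\<^sup>2 / 2"
  obtains x s lam where "s \<in> S" "(norm (s - xbar))\<^sup>2 \<le> B / n"
    "\<And>l. l \<in> \<Lambda> \<Longrightarrow> (norm (x l - s))\<^sup>2 \<le> 2 * B / n\<^sup>2"
    "\<And>k. k \<in> K \<Longrightarrow> 0 \<le> lam k" "(\<Sum>k\<in>K. lam k) = 1"
    "norm (s - xbar) < r \<Longrightarrow> (\<Sum>l\<in>\<Lambda>. (2 * n) *\<^sub>R (x l - s)) - 2 *\<^sub>R (s - xbar) \<in> frechet_normals s S"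
    "\<And>l. l \<in> \<Lambda> \<Longrightarrow> norm (x l - xbar) < r \<Longrightarrow>
        ((2 * n) *\<^sub>R (s - x l), - (\<Sum>k\<in>K. lam k * c k l)) \<in> frechet_normals (x l, u l (x l)) (epi (ereal \<circ> u l))"
proof -
  define a where "a x k = (\<Sum>l\<in>\<Lambda>. c k l * u l (x l))" for x k
  define D where "D = PiE UNIV (\<lambda>_::'l. cball xbar r) \<times> (S \<inter> cball xbar r)"
  \<comment> \<open>The last square localizes at \<open>xbar\<close>: other points of
    \<open>S\<close> may attain the same maximum, and it forces \<open>s\<close> towards
    \<open>xbar\<close>. Inner products replace squared norms because they differentiate
    directly.\<close>
  define \<theta> where "\<theta> p = lse n K (a (fst p)) +
      (n * (\<Sum>l\<in>\<Lambda>. inner (fst p l - snd p) (fst p l - snd p)) + inner (snd p - xbar) (snd p - xbar))" for p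
  have "compact D"
    unfolding D_def using S by (intro compact_Times compact_PiE_UNIV closed_Int_compact) auto
  moreover have base: "(\<lambda>_. xbar, xbar) \<in> D"
    using S \<open>r > 0\<close> by (auto simp: D_def)
  moreover have "continuous_on D \<theta>"
  proof -
    have coord: "continuous_on D (\<lambda>p. fst p l)" for l
      using continuous_on_compose2[OF continuous_on_product_coordinates[of l] continuous_on_fst[OF continuous_on_id]]
      by blast
    have "continuous_on D (\<lambda>p. u l (fst p l))" if "l \<in> \<Lambda>" for l
      by (rule continuous_on_compose2[OF lipschitz_on_continuous_on[OF lip[OF that]] coord])
         (auto simp: D_def PiE_iff)
    then show ?thesis
      unfolding \<theta>_def a_def
      by (intro continuous_intros continuous_on_lse fin coord) auto
  qed
  ultimately obtain p where p: "p \<in> D" "\<And>q. q \<in> D \<Longrightarrow> \<theta> p \<le> \<theta> q"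
    using continuous_attains_inf[of D \<theta>] by blast
  obtain x s where xs: "p = (x, s)" by (cases p)
  have x: "x l \<in> cball xbar r" for l using p(1) by (auto simp: D_def xs PiE_iff)
  have s: "s \<in> S" "s \<in> cball xbar r" using p(1) by (auto simp: D_def xs)
  have CL: "c k l * (L * d) \<le> C * L * d" if "k \<in> K" "l \<in> \<Lambda>" "d \<ge> 0" for k l d
  proof -
    have "L \<ge> 0" using lip that lipschitz_on_nonneg by blast
    then have "c k l * (L * d) \<le> C * (L * d)" using c that by (intro mult_right_mono) auto
    then show ?thesis by (simp add: mult_ac)
  qed
  have bound: "(\<Sum>l\<in>\<Lambda>. n / 2 * (norm (x l - s))\<^sup>2) + (norm (s - xbar))\<^sup>2 \<le> B / n"
  proof -
    have "\<theta> p \<le> \<theta> (\<lambda>_. xbar, xbar)" by (rule p(2)[OF base])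
    also have "\<dots> = lse n K (a (\<lambda>_. xbar))" by (simp add: \<theta>_def)
    also have "\<dots> \<le> lse n K (\<lambda>_. M)"
      using fin \<open>n > 0\<close> le by (intro lse_mono) (auto simp: a_def)
    also have "\<dots> = M + ln (card K) / n" using fin \<open>n > 0\<close> by (intro lse_const) auto
    finally have up: "\<theta> p \<le> M + ln (card K) / n" .
    \<comment> \<open>The lower bound \<open>M\<close> is available only at points of
      \<open>S\<close>, so the values at the copies \<open>x l\<close> have to be compared with
      those at \<open>s\<close>.\<close>
    obtain k where k: "k \<in> K" "M \<le> (\<Sum>l\<in>\<Lambda>. c k l * u l s)" using ge s by auto
    have "(\<Sum>l\<in>\<Lambda>. c k l * u l s + (n / 2 * (norm (x l - s))\<^sup>2 - (C * L)\<^sup>2 / (2 * n)))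
        \<le> (\<Sum>l\<in>\<Lambda>. c k l * u l (x l) + n * (norm (x l - s))\<^sup>2)"
    proof (rule sum_mono)
      fix l assume l: "l \<in> \<Lambda>"
      define d where "d = norm (x l - s)"
      have "u l s - u l (x l) \<le> L * d"
        using lipschitz_onD[OF lip[OF l] s(2) x[of l]] by (simp add: d_def dist_norm norm_minus_commute)
      then have "c k l * (u l s - u l (x l)) \<le> c k l * (L * d)"
        using c k l by (intro mult_left_mono) auto
      then have 1: "c k l * u l s - c k l * u l (x l) \<le> C * L * d"
        using CL[OF k(1) l, of d] by (simp add: d_def algebra_simps)
      \<comment> \<open>Completing the square: half of the penalty absorbs the Lipschitz error
        \<open>C * L * d\<close>, and the other half survives as the distance bound.\<close>
      have "0 \<le> n / 2 * (d - C * L / n)\<^sup>2" using \<open>n > 0\<close> by simp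
      also have "\<dots> = n / 2 * d\<^sup>2 - C * L * d + (C * L)\<^sup>2 / (2 * n)"
        using \<open>n > 0\<close> by (simp add: power2_eq_square field_simps)
      finally show "c k l * u l s + (n / 2 * (norm (x l - s))\<^sup>2 - (C * L)\<^sup>2 / (2 * n))
        \<le> c k l * u l (x l) + n * (norm (x l - s))\<^sup>2"
        using 1 by (simp add: d_def)
    qed
    then have "M + (\<Sum>l\<in>\<Lambda>. n / 2 * (norm (x l - s))\<^sup>2) - card \<Lambda> * ((C * L)\<^sup>2 / (2 * n))
        \<le> a x k + n * (\<Sum>l\<in>\<Lambda>. (norm (x l - s))\<^sup>2)"
      using k(2) by (simp add: a_def sum.distrib sum_subtractf sum_distrib_left)
    moreover have "a x k \<le> lse n K (a x)" using fin k \<open>n > 0\<close> by (intro lse_ge) auto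
    ultimately have "M + (\<Sum>l\<in>\<Lambda>. n / 2 * (norm (x l - s))\<^sup>2) - card \<Lambda> * ((C * L)\<^sup>2 / (2 * n)) + (norm (s - xbar))\<^sup>2 \<le> \<theta> p"
      by (simp add: \<theta>_def xs power2_norm_eq_inner)
    with up have "(\<Sum>l\<in>\<Lambda>. n / 2 * (norm (x l - s))\<^sup>2) + (norm (s - xbar))\<^sup>2
        \<le> ln (card K) / n + card \<Lambda> * ((C * L)\<^sup>2 / (2 * n))" by simp
    also have "\<dots> = B / n" using \<open>n > 0\<close> by (simp add: B field_simps)
    finally show ?thesis .
  qed
  define lam where "lam = softmax n K (a x)"
  show thesis
  proof
    show "s \<in> S" by (rule s)
    have "(\<Sum>l\<in>\<Lambda>. n / 2 * (norm (x l - s))\<^sup>2) \<ge> 0"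
      using \<open>n > 0\<close> by (intro sum_nonneg) auto
    with bound show "(norm (s - xbar))\<^sup>2 \<le> B / n" by linarith
    show "(norm (x l - s))\<^sup>2 \<le> 2 * B / n\<^sup>2" if "l \<in> \<Lambda>" for l
    proof -
      have "n / 2 * (norm (x l - s))\<^sup>2 \<le> (\<Sum>l\<in>\<Lambda>. n / 2 * (norm (x l - s))\<^sup>2)"
        using fin \<open>n > 0\<close> that by (intro member_le_sum) auto
      also have "\<dots> \<le> B / n" using bound by (smt (verit) zero_le_power2)
      finally show ?thesis using \<open>n > 0\<close> by (simp add: field_simps power2_eq_square)
    qed
    show "0 \<le> lam k" for k by (simp add: lam_def softmax_nonneg)
    show "(\<Sum>k\<in>K. lam k) = 1" using fin by (simp add: lam_def sum_softmax)
    show "(\<Sum>l\<in>\<Lambda>. (2 * n) *\<^sub>R (x l - s)) - 2 *\<^sub>R (s - xbar) \<in> frechet_normals s S"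
      if sr: "norm (s - xbar) < r"
    proof (rule frechet_normals_local_min)
      let ?\<phi> = "\<lambda>s'. n * (\<Sum>l\<in>\<Lambda>. inner (x l - s') (x l - s')) + inner (s' - xbar) (s' - xbar)"
      show "(?\<phi> has_derivative (\<lambda>v. - inner ((\<Sum>l\<in>\<Lambda>. (2 * n) *\<^sub>R (x l - s)) - 2 *\<^sub>R (s - xbar)) v)) (at s within S)"
        by (rule derivative_eq_intros refl)+
           (auto simp: fun_eq_iff inner_diff_left inner_diff_right inner_sum_left inner_sum_right inner_commute
              sum_distrib_left sum_subtractf sum.distrib sum_negf algebra_simps)
      \<comment> \<open>The strict inequality \<open>sr\<close> makes the ball constraint inactive
        near \<open>s\<close>, so minimality over \<open>D\<close> becomes local minimality over
        \<open>S\<close>.\<close>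
      have "\<theta> p \<le> \<theta> (x, s')" if "s' \<in> S" "dist s' s < r - norm (s - xbar)" for s'
      proof (rule p(2))
        have "dist xbar s' \<le> r"
          using that(2) dist_triangle[of xbar s' s] by (simp add: dist_norm norm_minus_commute)
        then show "(x, s') \<in> D" using that(1) x by (auto simp: D_def)
      qed
      then show "\<forall>\<^sub>F s' in at s within S. ?\<phi> s \<le> ?\<phi> s'"
        unfolding eventually_at using sr
        by (intro exI[of _ "r - norm (s - xbar)"]) (auto simp: \<theta>_def xs)
    qed
    show "((2 * n) *\<^sub>R (s - x l), - (\<Sum>k\<in>K. lam k * c k l)) \<in> frechet_normals (x l, u l (x l)) (epi (ereal \<circ> u l))"
      if l: "l \<in> \<Lambda>" and xr: "norm (x l - xbar) < r" for l
    proof (rule frechet_normals_local_min)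
      define A where "A k = (\<Sum>l'\<in>\<Lambda> - {l}. c k l' * u l' (x l'))" for k
      \<comment> \<open>The nonsmooth value \<open>u l x'\<close> becomes the free variable
        \<open>snd q\<close>, constrained by the epigraph. The objective is then differentiable, and
        the nonsmoothness sits in the set.\<close>
      let ?\<phi> = "\<lambda>q::'a \<times> real. lse n K (\<lambda>k. A k + c k l * snd q) + n * inner (fst q - s) (fst q - s)"
      let ?x0 = "(x l, u l (x l))" and ?E = "epi (ereal \<circ> u l)"
      have ax: "a (x(l := x')) = (\<lambda>k. A k + c k l * u l x')" for x'
        using fin l by (auto simp: a_def A_def fun_eq_iff sum.remove intro!: sum.cong)
      have lam: "lam = softmax n K (\<lambda>k. A k + c k l * snd ?x0)"
        using ax[of "x l"] by (simp add: lam_def)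
      have "((\<lambda>q::'a \<times> real. lse n K (\<lambda>k. A k + c k l * snd q)) has_derivative
          (\<lambda>v. snd v * (\<Sum>k\<in>K. lam k * c k l))) (at ?x0 within ?E)"
        unfolding lam by (rule DERIV_compose_FDERIV[OF DERIV_lse[OF fin(2,3) \<open>n > 0\<close>]])
           (rule derivative_eq_intros refl)+
      moreover have "((\<lambda>q::'a \<times> real. n * inner (fst q - s) (fst q - s)) has_derivative
          (\<lambda>v. n * (2 * inner (x l - s) (fst v)))) (at ?x0 within ?E)"
        by (rule derivative_eq_intros refl)+ (auto simp: fun_eq_iff inner_commute)
      ultimately have "(?\<phi> has_derivative (\<lambda>v. snd v * (\<Sum>k\<in>K. lam k * c k l) + n * (2 * inner (x l - s) (fst v))))
          (at ?x0 within ?E)"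
        by (rule has_derivative_add)
      then show "(?\<phi> has_derivative (\<lambda>v. - inner ((2 * n) *\<^sub>R (s - x l), - (\<Sum>k\<in>K. lam k * c k l)) v)) (at ?x0 within ?E)"
        by (rule has_derivative_eq_rhs) (auto simp: fun_eq_iff inner_diff_left algebra_simps)
      have "?\<phi> ?x0 \<le> ?\<phi> q" if q: "q \<in> ?E" "dist q ?x0 < r - norm (x l - xbar)" for q
      proof -
        let ?x' = "x(l := fst q)"
        have "dist (fst q) (x l) < r - norm (x l - xbar)"
          using q(2) dist_fst_le[of q ?x0] by simp
        then have "dist xbar (fst q) \<le> r"
          using dist_triangle[of xbar "fst q" "x l"] by (simp add: dist_norm norm_minus_commute)
        then have "(?x', s) \<in> D" using x s by (auto simp: D_def)
        then have "\<theta> p \<le> \<theta> (?x', s)" by (rule p(2))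
        moreover have split: "\<theta> (x(l := y), s) = ?\<phi> (y, u l y) +
            (n * (\<Sum>l'\<in>\<Lambda> - {l}. inner (x l' - s) (x l' - s)) + inner (s - xbar) (s - xbar))" for y
        proof -
          have "(\<Sum>l'\<in>\<Lambda>. inner ((x(l := y)) l' - s) ((x(l := y)) l' - s)) =
              inner (y - s) (y - s) + (\<Sum>l'\<in>\<Lambda> - {l}. inner (x l' - s) (x l' - s))"
            using fin l by (auto simp: sum.remove intro!: sum.cong)
          then show ?thesis
            unfolding \<theta>_def fst_conv snd_conv ax by (simp only: distrib_left add.assoc)
        qed
        ultimately have "?\<phi> ?x0 \<le> ?\<phi> (fst q, u l (fst q))"
          using split[of "x l"] split[of "fst q"] by (simp add: xs)
        \<comment> \<open>Raising \<open>snd q\<close> above \<open>u l (fst q)\<close> cannot lower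
          the objective, because \<open>c k l\<close> is nonnegative and \<open>lse\<close> is
          monotone.\<close>
        also have "\<dots> \<le> ?\<phi> q"
          using fin \<open>n > 0\<close> c l q(1)
          by (auto simp: epi_real intro!: lse_mono mult_left_mono)
        finally show ?thesis .
      qed
      then show "\<forall>\<^sub>F q in at ?x0 within ?E. ?\<phi> ?x0 \<le> ?\<phi> q"
        unfolding eventually_at using xr
        by (intro exI[of _ "r - norm (x l - xbar)"]) auto
    qed
  qed
qed

section \<open>Passage to the limit in the penalized problems\<close>

lemma tendsto_fun_apply:
  fixes f :: "'b \<Rightarrow> 'l \<Rightarrow> 'c::topological_space"
  assumes "(f \<longlongrightarrow> g) F"
  shows "((\<lambda>x. f x l) \<longlongrightarrow> g l) F"
  by (rule continuous_on_tendsto_compose[OF continuous_on_product_coordinates[of l] assms]) auto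

text \<open>The distances \<open>norm (x l - s)\<close> are of order 1 / n, so the vectors 2 n (s -
  x l) stay bounded and a subsequence converges; countable index types make the product topologies
  first countable, so compactness yields such a subsequence. A limit is divided by its total weight
  to give a subgradient, whence the restriction to positive weights. The lower bound is assumed only
  near \<open>xbar\<close>, so that inactive functions can be discarded before applying the
  rule.\<close>

lemma active_multiplier_rule:
  fixes u :: "'l::countable \<Rightarrow> 'a::euclidean_space \<Rightarrow> real" and c :: "'k::countable \<Rightarrow> 'l \<Rightarrow> real"
  assumes fin: "finite \<Lambda>" "finite K" "K \<noteq> {}"
    and lip: "\<And>l. l \<in> \<Lambda> \<Longrightarrow> locally_lipschitzian (u l)"
    and c: "\<And>k l. k \<in> K \<Longrightarrow> l \<in> \<Lambda> \<Longrightarrow> 0 \<le> c k l"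
    and S: "closed S" "xbar \<in> S"
    and le: "\<And>k. k \<in> K \<Longrightarrow> (\<Sum>l\<in>\<Lambda>. c k l * u l xbar) \<le> M"
    and ge: "r\<^sub>0 > 0" "\<And>x. x \<in> S \<inter> cball xbar r\<^sub>0 \<Longrightarrow> \<exists>k\<in>K. M \<le> (\<Sum>l\<in>\<Lambda>. c k l * u l x)"
  obtains lam \<xi> where "\<And>k. k \<in> K \<Longrightarrow> 0 \<le> lam k" "(\<Sum>k\<in>K. lam k) = 1"
    "\<And>l. l \<in> \<Lambda> \<Longrightarrow> (\<Sum>k\<in>K. lam k * c k l) > 0 \<Longrightarrow> \<xi> l \<in> limiting_subdiff (ereal \<circ> u l) xbar"
    "- (\<Sum>l\<in>\<Lambda>. (\<Sum>k\<in>K. lam k * c k l) *\<^sub>R \<xi> l) \<in> limiting_normal_cone xbar S"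
proof -
  obtain r\<^sub>1 L where r1: "r\<^sub>1 > 0" "\<And>l. l \<in> \<Lambda> \<Longrightarrow> L-lipschitz_on (cball xbar r\<^sub>1) (u l)"
    using locally_lipschitzian_uniform[of \<Lambda> u xbar] fin lip by blast
  define r where "r = min r\<^sub>0 r\<^sub>1"
  have "r > 0" using r1 ge by (simp add: r_def)
  have lip_r: "L-lipschitz_on (cball xbar r) (u l)" if "l \<in> \<Lambda>" for l
    using r1(2)[OF that] by (rule lipschitz_on_mono) (auto simp: r_def)
  have ge_r: "\<exists>k\<in>K. M \<le> (\<Sum>l\<in>\<Lambda>. c k l * u l x)" if "x \<in> S \<inter> cball xbar r" for x
    using that by (intro ge(2)) (auto simp: r_def)
  \<comment> \<open>For empty \<open>\<Lambda>\<close> this maximum is unspecified, but the bound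
    \<open>cC\<close> is then vacuous.\<close>
  define C where "C = Max ((\<lambda>(k, l). c k l) ` (K \<times> \<Lambda>))"
  have cC: "0 \<le> c k l \<and> c k l \<le> C" if "k \<in> K" "l \<in> \<Lambda>" for k l
    using that fin c unfolding C_def by (auto intro!: Max_ge)
  define B where "B = ln (card K) + card \<Lambda> * (C * L)\<^sup>2 / 2"
  \<comment> \<open>The shift by one keeps the penalty parameter positive at
    \<open>j = 0\<close>.\<close>
  define N where "N j = real (Suc j)" for j
  have N: "N j > 0" for j by (simp add: N_def)
  define Q where "Q j x s \<mu> \<longleftrightarrow> s \<in> S \<and> (norm (s - xbar))\<^sup>2 \<le> B / N j \<and>
    (\<forall>l\<in>\<Lambda>. (norm (x l - s))\<^sup>2 \<le> 2 * B / (N j)\<^sup>2) \<and>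
    (\<forall>k\<in>K. 0 \<le> \<mu> k) \<and> (\<Sum>k\<in>K. \<mu> k) = 1 \<and>
    (norm (s - xbar) < r \<longrightarrow> (\<Sum>l\<in>\<Lambda>. (2 * N j) *\<^sub>R (x l - s)) - 2 *\<^sub>R (s - xbar) \<in> frechet_normals s S) \<and>
    (\<forall>l\<in>\<Lambda>. norm (x l - xbar) < r \<longrightarrow>
      ((2 * N j) *\<^sub>R (s - x l), - (\<Sum>k\<in>K. \<mu> k * c k l)) \<in> frechet_normals (x l, u l (x l)) (epi (ereal \<circ> u l)))"
    for j x s \<mu>
  have "\<exists>x s \<mu>. Q j x s \<mu>" for j
  proof (rule penalized_minimizer[OF fin N[of j] \<open>r > 0\<close> lip_r cC S le ge_r B_def], goal_cases)
    case (6 x s \<mu>)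
    then have "Q j x s \<mu>" unfolding Q_def by simp
    then show ?case by blast
  qed auto
  then obtain x s \<mu> where Q: "\<And>j. Q j (x j) (s j) (\<mu> j)" by metis
  have BN: "(\<lambda>j. B / N j) \<longlonglongrightarrow> 0" "(\<lambda>j. 2 * B / (N j)\<^sup>2) \<longlonglongrightarrow> 0"
  proof -
    show "(\<lambda>j. B / N j) \<longlonglongrightarrow> 0"
      unfolding N_def by (rule LIMSEQ_Suc[OF lim_const_over_n])
    have "(\<lambda>j. (2 * B / N j) * (1 / N j)) \<longlonglongrightarrow> 0 * 0"
      unfolding N_def by (intro tendsto_mult LIMSEQ_Suc[OF lim_const_over_n])
    then show "(\<lambda>j. 2 * B / (N j)\<^sup>2) \<longlonglongrightarrow> 0" by (simp add: power2_eq_square)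
  qed
  have norm_lim: "f \<longlonglongrightarrow> 0" if "\<And>j. (norm (f j))\<^sup>2 \<le> b j" "b \<longlonglongrightarrow> 0" for f :: "nat \<Rightarrow> 'a" and b
  proof -
    have "(\<lambda>j. sqrt (b j)) \<longlonglongrightarrow> 0" using tendsto_real_sqrt[OF that(2)] by simp
    then show ?thesis
      by (rule Lim_null_comparison[rotated]) (simp add: that(1) real_le_rsqrt)
  qed
  have s_lim: "s \<longlonglongrightarrow> xbar"
    by (rule LIM_zero_cancel, rule norm_lim[OF _ BN(1)]) (use Q in \<open>auto simp: Q_def\<close>)
  have x_lim: "(\<lambda>j. x j l) \<longlonglongrightarrow> xbar" if "l \<in> \<Lambda>" for l
  proof -
    have "(\<lambda>j. x j l - s j) \<longlonglongrightarrow> 0"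
      by (rule norm_lim[OF _ BN(2)]) (use Q that in \<open>auto simp: Q_def\<close>)
    from tendsto_add[OF this s_lim] show ?thesis by simp
  qed
  \<comment> \<open>The value 0 outside \<open>\<Lambda>\<close>, and likewise outside
    \<open>K\<close> for \<open>\<nu>\<close>, places the whole functions in the compact product
    \<open>T\<close>.\<close>
  define z where "z j l = (if l \<in> \<Lambda> then (2 * N j) *\<^sub>R (s j - x j l) else 0)" for j l
  define \<nu> where "\<nu> j k = (if k \<in> K then \<mu> j k else 0)" for j k
  \<comment> \<open>The radius comes from \<open>norm (x j l - s j)\<close> squared being at most
    \<open>2 * B / (N j)\<^sup>2\<close>, multiplied by the square of the factor
    \<open>2 * N j\<close>.\<close>
  define T where "T = PiE UNIV (\<lambda>_::'l. cball (0::'a) (sqrt (8 * B))) \<times> PiE UNIV (\<lambda>_::'k. {0..1::real})"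
  have "B \<ge> 0"
  proof -
    have "0 \<le> B / N 0" using Q[of 0] unfolding Q_def by (meson order_trans zero_le_power2)
    then show ?thesis by (simp add: N_def)
  qed
  have "(z j, \<nu> j) \<in> T" for j
  proof -
    have "norm (z j l) \<le> sqrt (8 * B)" for l
    proof (cases "l \<in> \<Lambda>")
      case True
      then have "(norm (x j l - s j))\<^sup>2 \<le> 2 * B / (N j)\<^sup>2" using Q by (auto simp: Q_def)
      then have "(N j)\<^sup>2 * (norm (s j - x j l))\<^sup>2 \<le> 2 * B"
        using N[of j] by (simp add: norm_minus_commute field_simps)
      moreover have "(norm (z j l))\<^sup>2 = 4 * ((N j)\<^sup>2 * (norm (s j - x j l))\<^sup>2)"
        using True by (simp add: z_def power_mult_distrib)
      ultimately have "(norm (z j l))\<^sup>2 \<le> 8 * B" by linarith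
      then show ?thesis by (rule real_le_rsqrt)
    qed (use \<open>B \<ge> 0\<close> in \<open>simp add: z_def\<close>)
    moreover have "\<mu> j k \<le> 1" if "k \<in> K" for k
      using member_le_sum[of k K "\<mu> j"] Q[of j] fin that by (auto simp: Q_def)
    ultimately show ?thesis using Q[of j] by (auto simp: T_def \<nu>_def Q_def)
  qed
  moreover have "seq_compact T"
    unfolding T_def by (intro compact_imp_seq_compact compact_Times compact_PiE_UNIV) auto
  ultimately obtain q \<rho> where \<rho>: "strict_mono \<rho>" "(\<lambda>j. (z (\<rho> j), \<nu> (\<rho> j))) \<longlonglongrightarrow> q"
    using seq_compactE[of T "\<lambda>j. (z j, \<nu> j)"] unfolding o_def by blast
  obtain zz lam where q: "q = (zz, lam)" by (cases q)
  have z_lim: "(\<lambda>j. z (\<rho> j) l) \<longlonglongrightarrow> zz l" for l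
    using tendsto_fun_apply[OF tendsto_fst[OF \<rho>(2)], of l] by (simp add: q)
  have \<nu>_lim: "(\<lambda>j. \<nu> (\<rho> j) k) \<longlonglongrightarrow> lam k" for k
    using tendsto_fun_apply[OF tendsto_snd[OF \<rho>(2)], of k] by (simp add: q)
  have s\<rho>: "(\<lambda>j. s (\<rho> j)) \<longlonglongrightarrow> xbar"
    using LIMSEQ_subseq_LIMSEQ[OF s_lim \<rho>(1)] by (simp add: o_def)
  have x\<rho>: "(\<lambda>j. x (\<rho> j) l) \<longlonglongrightarrow> xbar" if "l \<in> \<Lambda>" for l
    using LIMSEQ_subseq_LIMSEQ[OF x_lim[OF that] \<rho>(1)] by (simp add: o_def)
  define w where "w j l = (\<Sum>k\<in>K. \<nu> j k * c k l)" for j l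
  define W where "W l = (\<Sum>k\<in>K. lam k * c k l)" for l
  have w_eq: "w j l = (\<Sum>k\<in>K. \<mu> j k * c k l)" for j l
    by (simp add: w_def \<nu>_def)
  have w_lim: "(\<lambda>j. w (\<rho> j) l) \<longlonglongrightarrow> W l" for l
    unfolding w_def W_def by (intro tendsto_intros \<nu>_lim)
  have lam: "0 \<le> lam k" for k
    by (rule LIMSEQ_le_const[OF \<nu>_lim]) (use Q in \<open>auto simp: \<nu>_def Q_def\<close>)
  have W: "0 \<le> W l" if "l \<in> \<Lambda>" for l
    unfolding W_def using lam c that by (intro sum_nonneg mult_nonneg_nonneg) auto
  have near: "\<forall>\<^sub>F j in sequentially. norm (x (\<rho> j) l - xbar) < e" if "l \<in> \<Lambda>" "e > 0" for l e
    using tendstoD[OF x\<rho>[OF that(1)] that(2)] by (simp add: dist_norm)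
  have normal: "\<forall>\<^sub>F j in sequentially. (z (\<rho> j) l, - w (\<rho> j) l) \<in>
      frechet_normals (x (\<rho> j) l, u l (x (\<rho> j) l)) (epi (ereal \<circ> u l))" if "l \<in> \<Lambda>" for l
    using near[OF that \<open>r > 0\<close>]
  proof eventually_elim
    case (elim j)
    then show ?case using Q[of "\<rho> j"] that by (simp add: Q_def z_def w_eq)
  qed
  \<comment> \<open>In particular \<open>zz l = 0\<close> when \<open>W l = 0\<close>, which justifies the quotient \<open>(1 / W l) *\<^sub>R zz l\<close> below.\<close>
  have zW: "norm (zz l) \<le> L * W l" if "l \<in> \<Lambda>" for l
  proof (rule tendsto_le[OF _ tendsto_mult[OF tendsto_const w_lim] tendsto_norm[OF z_lim]])
    \<comment> \<open>Once \<open>x (\<rho> j) l\<close> is within \<open>r / 2\<close> of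
      \<open>xbar\<close>, its own ball of radius \<open>r / 2\<close> lies in
      \<open>cball xbar r\<close>, so the same \<open>L\<close> works for all such
      \<open>j\<close>.\<close>
    have "r / 2 > 0" using \<open>r > 0\<close> by simp
    from normal[OF that] near[OF that this]
    show "\<forall>\<^sub>F j in sequentially. norm (z (\<rho> j) l) \<le> L * w (\<rho> j) l"
    proof eventually_elim
      case (elim j)
      have "cball (x (\<rho> j) l) (r / 2) \<subseteq> cball xbar r"
        using elim(2) by (auto simp: cball_subset_cball_iff dist_norm)
      from lipschitz_on_subset[OF lip_r[OF that] this] \<open>r / 2 > 0\<close> elim(1)
      show ?case by (rule frechet_normal_epi_bound)
    qed
  qed simp
  show thesis
  proof
    show "0 \<le> lam k" for k by (rule lam)
    have "(\<lambda>j. \<Sum>k\<in>K. \<nu> (\<rho> j) k) \<longlonglongrightarrow> (\<Sum>k\<in>K. lam k)"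
      by (intro tendsto_intros \<nu>_lim)
    moreover have "(\<Sum>k\<in>K. \<nu> j k) = 1" for j using Q[of j] by (simp add: \<nu>_def Q_def)
    ultimately have "(\<lambda>j. 1) \<longlonglongrightarrow> (\<Sum>k\<in>K. lam k)" by simp
    then show "(\<Sum>k\<in>K. lam k) = 1" by (simp add: LIMSEQ_const_iff)
    show "(1 / W l) *\<^sub>R zz l \<in> limiting_subdiff (ereal \<circ> u l) xbar"
      if l: "l \<in> \<Lambda>" and "(\<Sum>k\<in>K. lam k * c k l) > 0" for l
      unfolding limiting_subdiff_real
    proof (rule limiting_normal_coneI)
      have "W l > 0" using that by (simp add: W_def)
      have "(\<lambda>j. u l (x (\<rho> j) l)) \<longlonglongrightarrow> u l xbar"
        by (rule isCont_tendsto_compose[OF locally_lipschitzian_isCont[OF lip[OF l]] x\<rho>[OF l]])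
      then show "(\<lambda>j. (x (\<rho> j) l, u l (x (\<rho> j) l))) \<longlonglongrightarrow> (xbar, u l xbar)"
        by (intro tendsto_Pair x\<rho> l)
      \<comment> \<open>Scaling by \<open>1 / w (\<rho> j) l\<close> brings the last component to
        -1, as the subdifferential demands.\<close>
      have "(\<lambda>j. (1 / w (\<rho> j) l) *\<^sub>R (z (\<rho> j) l, - w (\<rho> j) l)) \<longlonglongrightarrow> (1 / W l) *\<^sub>R (zz l, - W l)"
        using \<open>W l > 0\<close> by (intro tendsto_intros z_lim w_lim) auto
      then show "(\<lambda>j. (1 / w (\<rho> j) l) *\<^sub>R (z (\<rho> j) l, - w (\<rho> j) l)) \<longlonglongrightarrow> ((1 / W l) *\<^sub>R zz l, - 1)"
        using \<open>W l > 0\<close> by simp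
      have "\<forall>\<^sub>F j in sequentially. w (\<rho> j) l > 0"
        using w_lim \<open>W l > 0\<close> by (rule order_tendstoD)
      with normal[OF l]
      show "\<forall>\<^sub>F j in sequentially. (x (\<rho> j) l, u l (x (\<rho> j) l)) \<in> epi (ereal \<circ> u l) \<and>
          (1 / w (\<rho> j) l) *\<^sub>R (z (\<rho> j) l, - w (\<rho> j) l) \<in>
          frechet_normals (x (\<rho> j) l, u l (x (\<rho> j) l)) (epi (ereal \<circ> u l))"
        by eventually_elim (auto simp: epi_real simp del: scaleR_Pair intro!: frechet_normals_scale)
    qed
    have "- (\<Sum>l\<in>\<Lambda>. zz l) \<in> limiting_normal_cone xbar S"
    proof (rule limiting_normal_coneI[OF s\<rho>])
      \<comment> \<open>The extra term \<open>2 *\<^sub>R (s (\<rho> j) - xbar)\<close> stems from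
        the localizing square and vanishes in the limit.\<close>
      have "(\<lambda>j. - (\<Sum>l\<in>\<Lambda>. z (\<rho> j) l) - 2 *\<^sub>R (s (\<rho> j) - xbar)) \<longlonglongrightarrow> - (\<Sum>l\<in>\<Lambda>. zz l) - 2 *\<^sub>R (xbar - xbar)"
        by (intro tendsto_intros z_lim s\<rho>)
      then show "(\<lambda>j. - (\<Sum>l\<in>\<Lambda>. z (\<rho> j) l) - 2 *\<^sub>R (s (\<rho> j) - xbar)) \<longlonglongrightarrow> - (\<Sum>l\<in>\<Lambda>. zz l)" by simp
      have "\<forall>\<^sub>F j in sequentially. norm (s (\<rho> j) - xbar) < r"
        using tendstoD[OF s\<rho> \<open>r > 0\<close>] by (simp add: dist_norm)
      then show "\<forall>\<^sub>F j in sequentially. s (\<rho> j) \<in> S \<and>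
          - (\<Sum>l\<in>\<Lambda>. z (\<rho> j) l) - 2 *\<^sub>R (s (\<rho> j) - xbar) \<in> frechet_normals (s (\<rho> j)) S"
      proof eventually_elim
        case (elim j)
        have "- (\<Sum>l\<in>\<Lambda>. z (\<rho> j) l) = (\<Sum>l\<in>\<Lambda>. (2 * N (\<rho> j)) *\<^sub>R (x (\<rho> j) l - s (\<rho> j)))"
          unfolding sum_negf[symmetric] by (intro sum.cong) (auto simp: z_def algebra_simps)
        then show ?case using elim Q[of "\<rho> j"] by (simp add: Q_def)
      qed
    qed
    moreover have "(\<Sum>l\<in>\<Lambda>. W l *\<^sub>R ((1 / W l) *\<^sub>R zz l)) = (\<Sum>l\<in>\<Lambda>. zz l)"
    proof (rule sum.cong[OF refl])
      fix l assume "l \<in> \<Lambda>"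
      then show "W l *\<^sub>R ((1 / W l) *\<^sub>R zz l) = zz l"
        using zW[of l] by (cases "W l = 0") auto
    qed
    ultimately show "- (\<Sum>l\<in>\<Lambda>. (\<Sum>k\<in>K. lam k * c k l) *\<^sub>R ((1 / W l) *\<^sub>R zz l)) \<in> limiting_normal_cone xbar S"
      by (simp add: W_def)
  qed
qed

text \<open>On the set \<open>{xbar}\<close> every function is minimal at \<open>xbar\<close>, and a
  single function receives the full weight 1, so the rule itself produces a subgradient. This
  supplies subgradients for summands of weight zero.\<close>

corollary limiting_subdiff_nonempty:
  fixes u :: "'a::euclidean_space \<Rightarrow> real"
  assumes "locally_lipschitzian u"
  shows "limiting_subdiff (ereal \<circ> u) xbar \<noteq> {}"
proof -
  obtain lam :: "unit \<Rightarrow> real" and \<xi> :: "unit \<Rightarrow> 'a" where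
    "(\<Sum>k\<in>{()}. lam k) = 1"
    "(\<Sum>k\<in>{()}. lam k * 1) > 0 \<Longrightarrow> \<xi> () \<in> limiting_subdiff (ereal \<circ> u) xbar"
    by (rule active_multiplier_rule[of "{()}" "{()}" "\<lambda>_. u" "\<lambda>_ _. 1" "{xbar}" xbar "u xbar" 1])
       (use assms in auto)
  then show ?thesis by auto
qed

text \<open>By continuity the functions with value below \<open>M\<close> at \<open>xbar\<close>
  stay below \<open>M\<close> nearby, so the active ones alone satisfy the lower bound there.
  Extending their multipliers by 0 gives complementary slackness.\<close>

theorem max_multiplier_rule:
  fixes u :: "'l::countable \<Rightarrow> 'a::euclidean_space \<Rightarrow> real" and c :: "'k::countable \<Rightarrow> 'l \<Rightarrow> real"
  assumes fin: "finite \<Lambda>" "finite K"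
    and lip: "\<And>l. l \<in> \<Lambda> \<Longrightarrow> locally_lipschitzian (u l)"
    and c: "\<And>k l. k \<in> K \<Longrightarrow> l \<in> \<Lambda> \<Longrightarrow> 0 \<le> c k l"
    and S: "closed S" "xbar \<in> S"
    and le: "\<And>k. k \<in> K \<Longrightarrow> (\<Sum>l\<in>\<Lambda>. c k l * u l xbar) \<le> M"
    and ge: "\<And>x. x \<in> S \<Longrightarrow> \<exists>k\<in>K. M \<le> (\<Sum>l\<in>\<Lambda>. c k l * u l x)"
  obtains lam \<xi> where "\<And>k. k \<in> K \<Longrightarrow> 0 \<le> lam k" "(\<Sum>k\<in>K. lam k) = 1"
    "\<And>k. k \<in> K \<Longrightarrow> lam k * ((\<Sum>l\<in>\<Lambda>. c k l * u l xbar) - M) = 0"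
    "\<And>l. l \<in> \<Lambda> \<Longrightarrow> \<xi> l \<in> limiting_subdiff (ereal \<circ> u l) xbar"
    "- (\<Sum>k\<in>K. lam k *\<^sub>R (\<Sum>l\<in>\<Lambda>. c k l *\<^sub>R \<xi> l)) \<in> limiting_normal_cone xbar S"
proof -
  define a where "a k x = (\<Sum>l\<in>\<Lambda>. c k l * u l x)" for k x
  define K\<^sub>0 where "K\<^sub>0 = {k \<in> K. a k xbar = M}"
  have K0: "finite K\<^sub>0" "K\<^sub>0 \<subseteq> K" using fin by (auto simp: K\<^sub>0_def)
  have "K\<^sub>0 \<noteq> {}"
    using ge[OF S(2)] le by (fastforce simp: K\<^sub>0_def a_def)
  have "\<forall>\<^sub>F x in nhds xbar. a k x < M" if "k \<in> K - K\<^sub>0" for k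
  proof -
    have "(a k \<longlongrightarrow> a k xbar) (nhds xbar)"
      unfolding a_def
      by (intro tendsto_intros) (use lip locally_lipschitzian_isCont in \<open>auto simp: isCont_def tendsto_at_iff_tendsto_nhds\<close>)
    moreover have "a k xbar < M" using that le[of k] by (auto simp: K\<^sub>0_def a_def less_le)
    ultimately show ?thesis by (rule order_tendstoD)
  qed
  then have "\<forall>\<^sub>F x in nhds xbar. \<forall>k\<in>K - K\<^sub>0. a k x < M"
    using fin by (auto intro: eventually_ball_finite)
  then obtain d where d: "d > 0" "\<And>x k. dist x xbar < d \<Longrightarrow> k \<in> K - K\<^sub>0 \<Longrightarrow> a k x < M"
    unfolding eventually_nhds_metric by blast
  have ge0: "\<exists>k\<in>K\<^sub>0. M \<le> (\<Sum>l\<in>\<Lambda>. c k l * u l x)" if x: "x \<in> S \<inter> cball xbar (d / 2)" for x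
  proof -
    obtain k where k: "k \<in> K" "M \<le> a k x" using ge x by (auto simp: a_def)
    have "dist x xbar < d" using x d(1) by (simp add: dist_commute)
    with k d(2) have "k \<in> K\<^sub>0" by force
    with k show ?thesis by (auto simp: a_def)
  qed
  have "d / 2 > 0" using d(1) by simp
  obtain lam \<xi> where lam: "\<And>k. k \<in> K\<^sub>0 \<Longrightarrow> 0 \<le> lam k" "(\<Sum>k\<in>K\<^sub>0. lam k) = 1"
    and \<xi>: "\<And>l. l \<in> \<Lambda> \<Longrightarrow> (\<Sum>k\<in>K\<^sub>0. lam k * c k l) > 0 \<Longrightarrow> \<xi> l \<in> limiting_subdiff (ereal \<circ> u l) xbar"
    and normal: "- (\<Sum>l\<in>\<Lambda>. (\<Sum>k\<in>K\<^sub>0. lam k * c k l) *\<^sub>R \<xi> l) \<in> limiting_normal_cone xbar S"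
    by (rule active_multiplier_rule[OF fin(1) K0(1) \<open>K\<^sub>0 \<noteq> {}\<close>, of u c S xbar M "d / 2"])
       (use lip c S le ge0 K0(2) \<open>d / 2 > 0\<close> in auto)
  define lam' where "lam' k = (if k \<in> K\<^sub>0 then lam k else 0)" for k
  define W where "W l = (\<Sum>k\<in>K\<^sub>0. lam k * c k l)" for l
  \<comment> \<open>At weight 0 the vector \<open>\<xi> l\<close> is uncontrolled; any subgradient
    may replace it, since its coefficient in the normal vanishes.\<close>
  define \<xi>' where "\<xi>' l = (if W l > 0 then \<xi> l else SOME v. v \<in> limiting_subdiff (ereal \<circ> u l) xbar)" for l
  have W0: "W l \<ge> 0" if "l \<in> \<Lambda>" for l
    unfolding W_def using lam c K0 that by (intro sum_nonneg mult_nonneg_nonneg) auto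
  have restrict: "(\<Sum>k\<in>K. lam' k *\<^sub>R f k) = (\<Sum>k\<in>K\<^sub>0. lam k *\<^sub>R f k)" for f :: "'k \<Rightarrow> 'a"
    using fin K0 by (intro sum.mono_neutral_cong_right) (auto simp: lam'_def)
  show thesis
  proof
    show "0 \<le> lam' k" for k using lam by (simp add: lam'_def)
    have "(\<Sum>k\<in>K. lam' k) = (\<Sum>k\<in>K\<^sub>0. lam k)"
      using fin K0 by (intro sum.mono_neutral_cong_right) (auto simp: lam'_def)
    then show "(\<Sum>k\<in>K. lam' k) = 1" using lam by simp
    show "lam' k * ((\<Sum>l\<in>\<Lambda>. c k l * u l xbar) - M) = 0" if "k \<in> K" for k
      by (simp add: lam'_def K\<^sub>0_def a_def)
    show "\<xi>' l \<in> limiting_subdiff (ereal \<circ> u l) xbar" if "l \<in> \<Lambda>" for l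
      using \<xi>[OF that] limiting_subdiff_nonempty[OF lip[OF that], of xbar]
      by (auto simp: \<xi>'_def W_def some_in_eq)
    have "(\<Sum>k\<in>K. lam' k *\<^sub>R (\<Sum>l\<in>\<Lambda>. c k l *\<^sub>R \<xi>' l)) = (\<Sum>l\<in>\<Lambda>. W l *\<^sub>R \<xi>' l)"
      unfolding restrict W_def by (simp add: scaleR_sum_right scaleR_sum_left sum.swap[of _ K\<^sub>0])
    also have "\<dots> = (\<Sum>l\<in>\<Lambda>. W l *\<^sub>R \<xi> l)"
      using W0 by (intro sum.cong) (force simp: \<xi>'_def)+
    finally show "- (\<Sum>k\<in>K. lam' k *\<^sub>R (\<Sum>l\<in>\<Lambda>. c k l *\<^sub>R \<xi>' l)) \<in> limiting_normal_cone xbar S"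
      using normal by (simp add: W_def)
  qed
qed

subsection \<open>Fractional interval-valued problems\<close>

text \<open>Treating \<open>U k\<close> and \<open>V k\<close> as two summands with their own copies
  of the variable gives each its own subgradient, instead of one subgradient of their
  combination.\<close>

corollary max_multiplier_rule_pairs:
  fixes U V :: "'k::countable \<Rightarrow> 'a::euclidean_space \<Rightarrow> real" and \<alpha> q :: "'k \<Rightarrow> real"
  assumes fin: "finite K"
    and lip: "\<And>k. k \<in> K \<Longrightarrow> locally_lipschitzian (U k)" "\<And>k. k \<in> K \<Longrightarrow> locally_lipschitzian (V k)"
    and nonneg: "\<And>k. k \<in> K \<Longrightarrow> 0 \<le> \<alpha> k" "\<And>k. k \<in> K \<Longrightarrow> 0 \<le> q k"
    and S: "closed S" "xbar \<in> S"
    and le: "\<And>k. k \<in> K \<Longrightarrow> \<alpha> k * (U k xbar + q k * V k xbar) \<le> M"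
    and ge: "\<And>x. x \<in> S \<Longrightarrow> \<exists>k\<in>K. M \<le> \<alpha> k * (U k x + q k * V k x)"
  obtains lam \<xi> \<zeta> where "\<And>k. k \<in> K \<Longrightarrow> 0 \<le> lam k" "(\<Sum>k\<in>K. lam k) = 1"
    "\<And>k. k \<in> K \<Longrightarrow> lam k * (\<alpha> k * (U k xbar + q k * V k xbar) - M) = 0"
    "\<And>k. k \<in> K \<Longrightarrow> \<xi> k \<in> limiting_subdiff (ereal \<circ> U k) xbar"
    "\<And>k. k \<in> K \<Longrightarrow> \<zeta> k \<in> limiting_subdiff (ereal \<circ> V k) xbar"
    "- (\<Sum>k\<in>K. (lam k * \<alpha> k) *\<^sub>R (\<xi> k + q k *\<^sub>R \<zeta> k)) \<in> limiting_normal_cone xbar S"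
proof -
  define u where "u l = (if snd l then U (fst l) else V (fst l))" for l :: "'k \<times> bool"
  \<comment> \<open>The index \<open>(k, True)\<close> stands for \<open>U k\<close> and
    \<open>(k, False)\<close> for \<open>V k\<close>; summands belonging to another index get
    coefficient 0.\<close>
  define c where "c k l = (if fst l = k then if snd l then \<alpha> k else \<alpha> k * q k else 0)" for k and l :: "'k \<times> bool"
  have sum_c: "(\<Sum>l\<in>K \<times> UNIV. c k l *\<^sub>R f l) = \<alpha> k *\<^sub>R (f (k, True) + q k *\<^sub>R f (k, False))"
    if "k \<in> K" for k and f :: "'k \<times> bool \<Rightarrow> 'b::real_vector"
  proof -
    have "(\<Sum>l\<in>K \<times> UNIV. c k l *\<^sub>R f l)
        = (\<Sum>k'\<in>K. if k' = k then \<alpha> k *\<^sub>R (f (k, True) + q k *\<^sub>R f (k, False)) else 0)"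
      unfolding sum.cartesian_product'
      by (intro sum.cong) (auto simp: UNIV_bool c_def scaleR_add_right)
    then show ?thesis using that fin by simp
  qed
  have sum_u: "(\<Sum>l\<in>K \<times> UNIV. c k l * u l x) = \<alpha> k * (U k x + q k * V k x)" if "k \<in> K" for k x
    using sum_c[OF that, of "\<lambda>l. u l x"] by (simp add: u_def)
  have "finite (K \<times> (UNIV :: bool set))" using fin by simp
  then obtain lam \<xi> where lam: "\<And>k. k \<in> K \<Longrightarrow> 0 \<le> lam k" "(\<Sum>k\<in>K. lam k) = 1"
      "\<And>k. k \<in> K \<Longrightarrow> lam k * ((\<Sum>l\<in>K \<times> UNIV. c k l * u l xbar) - M) = 0"
    and \<xi>: "\<And>l. l \<in> K \<times> UNIV \<Longrightarrow> \<xi> l \<in> limiting_subdiff (ereal \<circ> u l) xbar"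
    and normal: "- (\<Sum>k\<in>K. lam k *\<^sub>R (\<Sum>l\<in>K \<times> UNIV. c k l *\<^sub>R \<xi> l)) \<in> limiting_normal_cone xbar S"
    by (rule max_multiplier_rule[OF _ fin, of _ u c S xbar M])
       (use lip nonneg S le ge in \<open>auto simp: sum_u\<close>, auto simp: u_def c_def)
  show thesis
  proof (rule that)
    show "\<xi> (k, True) \<in> limiting_subdiff (ereal \<circ> U k) xbar" if "k \<in> K" for k
      using \<xi>[of "(k, True)"] that by (simp add: u_def)
    show "\<xi> (k, False) \<in> limiting_subdiff (ereal \<circ> V k) xbar" if "k \<in> K" for k
      using \<xi>[of "(k, False)"] that by (simp add: u_def)
    show "- (\<Sum>k\<in>K. (lam k * \<alpha> k) *\<^sub>R (\<xi> (k, True) + q k *\<^sub>R \<xi> (k, False))) \<in> limiting_normal_cone xbar S"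
      using normal by (simp add: sum_c)
  qed (use lam in \<open>auto simp: sum_u\<close>)
qed

lemma sum_in_set_sum:
  assumes "finite I" "\<And>i. i \<in> I \<Longrightarrow> s i \<in> A i"
  shows "sum s I \<in> sum A I"
  using assms by (auto simp: set_sum_alt)

text \<open>\<open>Interval\<close> returns its end points only for ordered pairs, so the order of
  the quotient end points has to be established before they can be compared.\<close>

lemma LU_sless_quotient_iff:
  assumes "0 \<le> a" "a \<le> b" "0 < c" "c \<le> d" "0 \<le> a'" "a' \<le> b'" "0 < c'" "c' \<le> d'"
  shows "LU_sless (interval_quotient (Interval (a, b)) (Interval (c, d)))
      (interval_quotient (Interval (a', b')) (Interval (c', d'))) \<longleftrightarrow> a / d < a' / d' \<and> b / c < b' / c'"
proof -
  have "a / d \<le> b / c" "a' / d' \<le> b' / c'" using assms by (auto intro!: frac_le)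
  then show ?thesis
    using assms by (simp add: LU_sless_def interval_quotient_def lower.rep_eq upper.rep_eq Interval_inverse)
qed

theorem theorem3p1:
  fixes S \<Omega> :: "(real ^ 'n) set"
    and m p :: nat
    and I J :: "nat set"
    and fL fU gL gU h :: "nat \<Rightarrow> real ^ 'n \<Rightarrow> real"
    and f g F :: "nat \<Rightarrow> real ^ 'n \<Rightarrow> real interval"
    and xbar :: "real ^ 'n"
  defines "I \<equiv> {1..m}"
    and "J \<equiv> {1..p}"
    and "f \<equiv> \<lambda>i x. Interval (fL i x, fU i x)"
    and "g \<equiv> \<lambda>i x. Interval (gL i x, gU i x)"
    and "F \<equiv> \<lambda>i x. interval_quotient (f i x) (g i x)"
    and "\<Omega> \<equiv> {x \<in> S. \<forall>j\<in>J. h j x \<le> 0}"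
  assumes "S \<noteq> {}" and "closed S"
    and "\<And>i. i \<in> I \<Longrightarrow> locally_lipschitzian (fL i)"
    and "\<And>i. i \<in> I \<Longrightarrow> locally_lipschitzian (fU i)"
    and "\<And>i. i \<in> I \<Longrightarrow> locally_lipschitzian (gL i)"
    and "\<And>i. i \<in> I \<Longrightarrow> locally_lipschitzian (gU i)"
    and "\<And>j. j \<in> J \<Longrightarrow> locally_lipschitzian (h j)"
    and "\<And>x i. x \<in> S \<Longrightarrow> i \<in> I \<Longrightarrow> 0 \<le> fL i x \<and> fL i x \<le> fU i x"
    and "\<And>x i. x \<in> S \<Longrightarrow> i \<in> I \<Longrightarrow> 0 < gL i x \<and> gL i x \<le> gU i x"
    and "type2_weakly_pareto I F \<Omega> xbar"
  shows "\<exists>lamL lamU \<mu> :: nat \<Rightarrow> real.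
    (\<forall>i\<in>I. lamL i \<ge> 0 \<and> lamU i \<ge> 0) \<and> (\<forall>j\<in>J. \<mu> j \<ge> 0) \<and>
    (\<Sum>i\<in>I. lamL i + lamU i) + (\<Sum>j\<in>J. \<mu> j) = 1 \<and>
    0 \<in> (\<Sum>i\<in>I. (lamL i / gU i xbar) \<odot>
            (limiting_subdiff (ereal \<circ> fL i) xbar \<ominus> (fL i xbar / gU i xbar) \<odot> upper_subdiff (ereal \<circ> gU i) xbar))
      + (\<Sum>i\<in>I. (lamU i / gL i xbar) \<odot>
            (limiting_subdiff (ereal \<circ> fU i) xbar \<ominus> (fU i xbar / gL i xbar) \<odot> upper_subdiff (ereal \<circ> gL i) xbar))
      + (\<Sum>j\<in>J. \<mu> j \<odot> limiting_subdiff (ereal \<circ> h j) xbar)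
      + limiting_normal_cone xbar S \<and>
    (\<forall>j\<in>J. \<mu> j * h j xbar = 0)"
proof -
  note lip = assms(9-13) and f_bounds = assms(14) and g_bounds = assms(15)
  have fin: "finite I" "finite J" by (simp_all add: I_def J_def)
  have xbar: "xbar \<in> S" "\<And>j. j \<in> J \<Longrightarrow> h j xbar \<le> 0"
    and optimal: "\<And>x. x \<in> \<Omega> \<Longrightarrow> \<exists>i\<in>I. \<not> LU_sless (F i x) (F i xbar)"
    using assms(16) by (auto simp: type2_weakly_pareto_def \<Omega>_def)
  have gU_pos: "0 < gU i x" if "x \<in> S" "i \<in> I" for i x
    using g_bounds[OF that] by linarith
  \<comment> \<open>The three blocks are the lower end points, the upper end points and the
    constraints.\<close>
  define K where "K = I <+> (I <+> J)"
  have K_iff: "Inl i \<in> K \<longleftrightarrow> i \<in> I" "Inr (Inl i) \<in> K \<longleftrightarrow> i \<in> I" "Inr (Inr j) \<in> K \<longleftrightarrow> j \<in> J" for i j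
    by (auto simp: K_def)
  define U where "U = case_sum fL (case_sum fU h)"
  \<comment> \<open>The denominators enter negated because the rule asks for nonnegative
    coefficients; subgradients of the negated functions are negatives of upper subgradients. A
    constraint is padded with the zero function.\<close>
  define V where "V = case_sum (\<lambda>i x. - gU i x) (case_sum (\<lambda>i x. - gL i x) (\<lambda>_::nat. \<lambda>_. 0))"
  define q where "q = case_sum (\<lambda>i. fL i xbar / gU i xbar) (case_sum (\<lambda>i. fU i xbar / gL i xbar) (\<lambda>_::nat. 0))"
  \<comment> \<open>Normalizing by the denominators at \<open>xbar\<close> produces the factors
    \<open>lamL i / gU i xbar\<close> and \<open>lamU i / gL i xbar\<close> while the multipliers
    themselves sum to 1.\<close>
  define \<alpha> where "\<alpha> = case_sum (\<lambda>i. 1 / gU i xbar) (case_sum (\<lambda>i. 1 / gL i xbar) (\<lambda>_::nat. 1))"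
  note defs = U_def V_def q_def \<alpha>_def
  \<comment> \<open>If all functions were negative at \<open>x\<close>, the third block would make
    \<open>x\<close> feasible and the first two would make both end points of every quotient
    strictly smaller than at \<open>xbar\<close>, against weak Pareto optimality.\<close>
  have ge: "\<exists>k\<in>K. 0 \<le> \<alpha> k * (U k x + q k * V k x)" if x: "x \<in> S" for x
  proof (rule ccontr)
    assume "\<not> (\<exists>k\<in>K. 0 \<le> \<alpha> k * (U k x + q k * V k x))"
    then have neg: "\<alpha> k * (U k x + q k * V k x) < 0" if "k \<in> K" for k
      using that by force
    have "h j x < 0" if "j \<in> J" for j
      using neg[of "Inr (Inr j)"] that by (simp add: K_iff defs)
    with x have "x \<in> \<Omega>" by (auto simp: \<Omega>_def less_imp_le)
    then obtain i where i: "i \<in> I" "\<not> LU_sless (F i x) (F i xbar)" using optimal by blast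
    have "fL i x - fL i xbar / gU i xbar * gU i x < 0"
      using neg[of "Inl i"] i(1) gU_pos[OF xbar(1) i(1)]
      by (simp add: K_iff defs divide_less_0_iff)
    then have 1: "fL i x / gU i x < fL i xbar / gU i xbar"
      using gU_pos[OF x i(1)] by (simp add: pos_divide_less_eq)
    have "fU i x - fU i xbar / gL i xbar * gL i x < 0"
      using neg[of "Inr (Inl i)"] i(1) g_bounds[OF xbar(1) i(1)]
      by (simp add: K_iff defs divide_less_0_iff)
    then have 2: "fU i x / gL i x < fU i xbar / gL i xbar"
      using g_bounds[OF x i(1)] by (simp add: pos_divide_less_eq)
    have "LU_sless (F i x) (F i xbar)"
      unfolding F_def f_def g_def
      using 1 2 f_bounds[OF x i(1)] g_bounds[OF x i(1)] f_bounds[OF xbar(1) i(1)] g_bounds[OF xbar(1) i(1)]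
      by (simp add: LU_sless_quotient_iff)
    with i(2) show False ..
  qed
  \<comment> \<open>The first two blocks vanish at \<open>xbar\<close> by the choice of
    \<open>q\<close>; only constraints can be negative there, so slackness concerns
    \<open>\<mu>\<close> alone.\<close>
  have le: "\<alpha> k * (U k xbar + q k * V k xbar) \<le> 0" if "k \<in> K" for k
    using that xbar gU_pos g_bounds by (fastforce simp: K_def defs)
  have lipU: "locally_lipschitzian (U k)" and lipV: "locally_lipschitzian (V k)" if "k \<in> K" for k
    using that lip by (auto simp: K_def defs locally_lipschitzian_uminus locally_lipschitzian_const)
  have nonneg: "0 \<le> \<alpha> k" "0 \<le> q k" if "k \<in> K" for k
  proof -
    have "0 \<le> fL i xbar" "0 \<le> fU i xbar" "0 \<le> gL i xbar" "0 \<le> gU i xbar" if "i \<in> I" for i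
      using f_bounds[OF xbar(1) that] g_bounds[OF xbar(1) that] by auto
    with that show "0 \<le> \<alpha> k" "0 \<le> q k" by (auto simp: K_def defs)
  qed
  have "finite K" using fin by (simp add: K_def)
  then obtain lam \<xi> \<zeta> where lam: "\<And>k. k \<in> K \<Longrightarrow> 0 \<le> lam k" "(\<Sum>k\<in>K. lam k) = 1"
      "\<And>k. k \<in> K \<Longrightarrow> lam k * (\<alpha> k * (U k xbar + q k * V k xbar) - 0) = 0"
    and \<xi>: "\<And>k. k \<in> K \<Longrightarrow> \<xi> k \<in> limiting_subdiff (ereal \<circ> U k) xbar"
    and \<zeta>: "\<And>k. k \<in> K \<Longrightarrow> \<zeta> k \<in> limiting_subdiff (ereal \<circ> V k) xbar"
    and normal: "- (\<Sum>k\<in>K. (lam k * \<alpha> k) *\<^sub>R (\<xi> k + q k *\<^sub>R \<zeta> k)) \<in> limiting_normal_cone xbar S"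
    by (rule max_multiplier_rule_pairs[of K U V \<alpha> q S xbar 0])
       (use lipU lipV nonneg \<open>closed S\<close> xbar(1) le ge in auto)
  define lamL where "lamL i = lam (Inl i)" for i
  define lamU where "lamU i = lam (Inr (Inl i))" for i
  define \<mu> where "\<mu> j = lam (Inr (Inr j))" for j
  define eL where "eL i = (lamL i / gU i xbar) *\<^sub>R (\<xi> (Inl i) - (fL i xbar / gU i xbar) *\<^sub>R - \<zeta> (Inl i))" for i
  define eU where "eU i = (lamU i / gL i xbar) *\<^sub>R
      (\<xi> (Inr (Inl i)) - (fU i xbar / gL i xbar) *\<^sub>R - \<zeta> (Inr (Inl i)))" for i
  define eh where "eh j = \<mu> j *\<^sub>R \<xi> (Inr (Inr j))" for j
  have upper: "- v \<in> upper_subdiff (ereal \<circ> G) xbar" if "v \<in> limiting_subdiff (ereal \<circ> (\<lambda>x. - G x)) xbar" for v G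
    using that by (auto simp: upper_subdiff_def o_def)
  have "eL i \<in> (lamL i / gU i xbar) \<odot> (limiting_subdiff (ereal \<circ> fL i) xbar \<ominus>
      (fL i xbar / gU i xbar) \<odot> upper_subdiff (ereal \<circ> gU i) xbar)" if "i \<in> I" for i
    using \<xi>[of "Inl i"] upper[OF \<zeta>[of "Inl i", unfolded V_def sum.case]] that
    unfolding eL_def set_scale_def set_diff_elementwise_def by (fastforce simp: K_iff defs)
  moreover have "eU i \<in> (lamU i / gL i xbar) \<odot> (limiting_subdiff (ereal \<circ> fU i) xbar \<ominus>
      (fU i xbar / gL i xbar) \<odot> upper_subdiff (ereal \<circ> gL i) xbar)" if "i \<in> I" for i
    using \<xi>[of "Inr (Inl i)"] upper[OF \<zeta>[of "Inr (Inl i)", unfolded V_def sum.case]] that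
    unfolding eU_def set_scale_def set_diff_elementwise_def by (fastforce simp: K_iff defs)
  moreover have "eh j \<in> \<mu> j \<odot> limiting_subdiff (ereal \<circ> h j) xbar" if "j \<in> J" for j
    using \<xi>[of "Inr (Inr j)"] that by (auto simp: eh_def set_scale_def K_iff defs)
  \<comment> \<open>The zero vector is written as the sum of the chosen subgradient terms plus its
    negative, the latter being the limiting normal to \<open>S\<close>.\<close>
  ultimately have mem: "sum eL I + sum eU I + sum eh J + - (sum eL I + sum eU I + sum eh J) \<in>
      (\<Sum>i\<in>I. (lamL i / gU i xbar) \<odot>
            (limiting_subdiff (ereal \<circ> fL i) xbar \<ominus> (fL i xbar / gU i xbar) \<odot> upper_subdiff (ereal \<circ> gU i) xbar))
      + (\<Sum>i\<in>I. (lamU i / gL i xbar) \<odot>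
            (limiting_subdiff (ereal \<circ> fU i) xbar \<ominus> (fU i xbar / gL i xbar) \<odot> upper_subdiff (ereal \<circ> gL i) xbar))
      + (\<Sum>j\<in>J. \<mu> j \<odot> limiting_subdiff (ereal \<circ> h j) xbar)
      + limiting_normal_cone xbar S"
  proof (intro set_plus_intro sum_in_set_sum fin)
    have "(\<Sum>k\<in>K. (lam k * \<alpha> k) *\<^sub>R (\<xi> k + q k *\<^sub>R \<zeta> k)) = sum eL I + sum eU I + sum eh J"
      using fin by (simp add: K_def sum.Plus o_def defs eL_def eU_def eh_def lamL_def lamU_def \<mu>_def add.assoc)
    with normal show "- (sum eL I + sum eU I + sum eh J) \<in> limiting_normal_cone xbar S" by simp
  qed
  have total: "(\<Sum>i\<in>I. lamL i + lamU i) + (\<Sum>j\<in>J. \<mu> j) = 1"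
    using lam(2) fin by (simp add: K_def sum.Plus o_def sum.distrib lamL_def lamU_def \<mu>_def add.assoc)
  show ?thesis
  proof (intro exI conjI ballI)
    show "0 \<le> lamL i" "0 \<le> lamU i" if "i \<in> I" for i
      using lam(1) that by (auto simp: lamL_def lamU_def K_iff)
    show "0 \<le> \<mu> j" if "j \<in> J" for j
      using lam(1) that by (auto simp: \<mu>_def K_iff)
    show "\<mu> j * h j xbar = 0" if "j \<in> J" for j
      using lam(3)[of "Inr (Inr j)"] that by (simp add: \<mu>_def K_iff defs)
  qed (use mem total in simp_all)
qed

end
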